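(* Let $(G,\precsim)$ be a C-quasi-ordered group and let $1\neq g\in G$ be o-type. Then both $G^g$ and $G_g$ are subgroups of $G$. Moreover, $G^g$ is convex and $G_g$ is the smallest normal strictly convex subgroup of $G^g$ such that the quasi-order induced by $\precsim$ on $G^g/G_g$ is order-type.
   Context: A quasi-order is a reflexive, transitive and total binary relation $\precsim$; $a\sim b$ means $a\precsim b\precsim a$, and $a\precnsim b$ means $a\precsim b$ and $a\nsim b$. An element $c$ is between $a$ and $b$ if $a\precsim c\precsim b$ or $b\precsim c\precsim a$. A subset $S$ is convex (resp. strictly convex) if for all $s,t\in S$, $s\precsim a\precsim t$ (resp. $s\precnsim a\precnsim t$) implies $a\in S$. A C-relation on a set is a ternary relation $C$ such that for all $x,y,z,w$: $C(x,y,z)\Rightarrow C(x,z,y)$; $C(x,y,z)\Rightarrow\neg C(y,x,z)$; $C(x,y,z)\Rightarrow C(w,y,z)\vee C(x,w,z)$; $x\neq y\Rightarrow C(x,y,y)$. On a group it is compatible if $C(x,y,z)$ implies $C(vxu,vyu,vzu)$ for all $x,y,z,u,v$. A C-quasi-order on a group $G$ is a quasi-order of the form $x\precsim y\Leftrightarrow\neg C(x,y,1)$ with $C$ a compatible C-relation (then unique: $C(x,y,z)\Leftrightarrow yz^{-1}\precnsim xz^{-1}$); a C-quasi-ordered group is a group with a C-quasi-order. It is order-type if its C-relation is $C(x,y,z)\Leftrightarrow(y<x\wedge z<x)\vee(y=z\neq x)$ for some total order $\leq$ making the group an ordered group ($x\leq y$ implies $xz\leq yz$ and $zx\leq zy$).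 If $H$ is a strictly convex normal subgroup of a C-quasi-ordered group $(K,\precsim)$, the C-quasi-order induced on $K/H$ is $aH\precsim bH\Leftrightarrow a\in H\vee(b\notin H\wedge a\precsim b)$. $g$ is o-type if $g=1$ or $g\nsim g^{-1}$; $o^+$-type if $g^{-1}\precnsim g$; $o^-$-type if $g\precnsim g^{-1}$. For $g$ $o^+$-type, $T_g^+$ is the set of $o^+$-type elements $h$ such that every element between $g$ and $h$ is $o^+$-type, $T_g:=T_g^+\cup(T_g^+)^{-1}$, $G_g:=\{h\mid\{h,h^{-1}\}\precsim g^{-1}\}$ (i.e. $h\precsim g^{-1}$ and $h^{-1}\precsim g^{-1}$). For $g$ $o^-$-type, $T_g:=T_{g^{-1}}$ and $G_g:=G_{g^{-1}}$. In both cases $G^g:=G_g\cup T_g$. *)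

theory Defs
  imports "HOL-Algebra.Coset"
begin

text \<open>
  Orders and quasi-orders on a set \<open>A\<close> are relations of type \<open>'a rel\<close> contained in \<open>A \<times> A\<close>;
  \<open>(a, b) \<in> r\<close> stands for \<open>a \<precsim> b\<close>.
\<close>

definition quasi_order_on :: "'a set \<Rightarrow> 'a rel \<Rightarrow> bool" where
  "quasi_order_on A r \<longleftrightarrow> preorder_on A r \<and> total_on A r"

definition qo_equiv :: "'a rel \<Rightarrow> 'a \<Rightarrow> 'a \<Rightarrow> bool" where
  "qo_equiv r a b \<longleftrightarrow> (a, b) \<in> r \<and> (b, a) \<in> r"

definition qo_less :: "'a rel \<Rightarrow> 'a \<Rightarrow> 'a \<Rightarrow> bool" where
  "qo_less r a b \<longleftrightarrow> (a, b) \<in> r \<and> \<not> qo_equiv r a b"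

definition qo_between :: "'a rel \<Rightarrow> 'a \<Rightarrow> 'a \<Rightarrow> 'a \<Rightarrow> bool" where
  "qo_between r a b c \<longleftrightarrow> ((a, c) \<in> r \<and> (c, b) \<in> r) \<or> ((b, c) \<in> r \<and> (c, a) \<in> r)"

definition qo_convex :: "'a set \<Rightarrow> 'a rel \<Rightarrow> 'a set \<Rightarrow> bool" where
  "qo_convex A r S \<longleftrightarrow>
     S \<subseteq> A \<and> (\<forall>s\<in>S. \<forall>t\<in>S. \<forall>a\<in>A. (s, a) \<in> r \<and> (a, t) \<in> r \<longrightarrow> a \<in> S)"

definition qo_strictly_convex :: "'a set \<Rightarrow> 'a rel \<Rightarrow> 'a set \<Rightarrow> bool" where
  "qo_strictly_convex A r S \<longleftrightarrow>
     S \<subseteq> A \<and> (\<forall>s\<in>S. \<forall>t\<in>S. \<forall>a\<in>A. qo_less r s a \<and> qo_less r a t \<longrightarrow> a \<in> S)"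

definition C_relation_on :: "'a set \<Rightarrow> ('a \<Rightarrow> 'a \<Rightarrow> 'a \<Rightarrow> bool) \<Rightarrow> bool" where
  "C_relation_on A C \<longleftrightarrow>
     (\<forall>x\<in>A. \<forall>y\<in>A. \<forall>z\<in>A. C x y z \<longrightarrow> C x z y) \<and>
     (\<forall>x\<in>A. \<forall>y\<in>A. \<forall>z\<in>A. C x y z \<longrightarrow> \<not> C y x z) \<and>
     (\<forall>x\<in>A. \<forall>y\<in>A. \<forall>z\<in>A. \<forall>w\<in>A. C x y z \<longrightarrow> C w y z \<or> C x w z) \<and>
     (\<forall>x\<in>A. \<forall>y\<in>A. x \<noteq> y \<longrightarrow> C x y y)"

definition compatible_C_relation ::
    "('a, 'b) monoid_scheme \<Rightarrow> ('a \<Rightarrow> 'a \<Rightarrow> 'a \<Rightarrow> bool) \<Rightarrow> bool" where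
  "compatible_C_relation G C \<longleftrightarrow>
     C_relation_on (carrier G) C \<and>
     (\<forall>x\<in>carrier G. \<forall>y\<in>carrier G. \<forall>z\<in>carrier G. \<forall>u\<in>carrier G. \<forall>v\<in>carrier G.
        C x y z \<longrightarrow>
          C (v \<otimes>\<^bsub>G\<^esub> x \<otimes>\<^bsub>G\<^esub> u) (v \<otimes>\<^bsub>G\<^esub> y \<otimes>\<^bsub>G\<^esub> u) (v \<otimes>\<^bsub>G\<^esub> z \<otimes>\<^bsub>G\<^esub> u))"

definition C_relation_of ::
    "('a, 'b) monoid_scheme \<Rightarrow> 'a rel \<Rightarrow> ('a \<Rightarrow> 'a \<Rightarrow> 'a \<Rightarrow> bool) \<Rightarrow> bool" where
  "C_relation_of G r C \<longleftrightarrow>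
     compatible_C_relation G C \<and>
     (\<forall>x\<in>carrier G. \<forall>y\<in>carrier G. (x, y) \<in> r \<longleftrightarrow> \<not> C x y \<one>\<^bsub>G\<^esub>)"

definition C_quasi_ordered_group :: "('a, 'b) monoid_scheme \<Rightarrow> 'a rel \<Rightarrow> bool" where
  "C_quasi_ordered_group G r \<longleftrightarrow>
     group G \<and> quasi_order_on (carrier G) r \<and> (\<exists>C. C_relation_of G r C)"

definition totally_ordered_group :: "('a, 'b) monoid_scheme \<Rightarrow> 'a rel \<Rightarrow> bool" where
  "totally_ordered_group G R \<longleftrightarrow>
     group G \<and> linear_order_on (carrier G) R \<and>
     (\<forall>x\<in>carrier G. \<forall>y\<in>carrier G. \<forall>z\<in>carrier G.
        (x, y) \<in> R \<longrightarrow> (x \<otimes>\<^bsub>G\<^esub> z, y \<otimes>\<^bsub>G\<^esub> z) \<in> R \<and> (z \<otimes>\<^bsub>G\<^esub> x, z \<otimes>\<^bsub>G\<^esub> y) \<in> R)"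

text \<open>
  On the carrier, the \<open>C\<close> below is unique, since compatibility gives
  \<open>C x y z \<longleftrightarrow> C (x z\<^sup>-\<^sup>1) (y z\<^sup>-\<^sup>1) 1\<close>.
\<close>

definition order_type :: "('a, 'b) monoid_scheme \<Rightarrow> 'a rel \<Rightarrow> bool" where
  "order_type G r \<longleftrightarrow>
     C_quasi_ordered_group G r \<and>
     (\<exists>C R. C_relation_of G r C \<and> totally_ordered_group G R \<and>
        (\<forall>x\<in>carrier G. \<forall>y\<in>carrier G. \<forall>z\<in>carrier G.
           C x y z \<longleftrightarrow>
             ((y, x) \<in> R \<and> y \<noteq> x \<and> (z, x) \<in> R \<and> z \<noteq> x) \<or> (y = z \<and> z \<noteq> x)))"

text \<open>
  If \<open>r\<close> is a C-quasi-order on \<open>K\<close> and \<open>H\<close> is a strictly convex normal subgroup, then the condition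
  on \<open>a\<close>, \<open>b\<close> does not depend on the chosen representatives: if \<open>a \<notin> H\<close> and \<open>h \<in> H\<close>, then
  \<open>a \<prec> a h\<close> would mean \<open>C (a h) a 1\<close>, hence \<open>C h 1 (a\<^sup>-\<^sup>1)\<close>, so \<open>1 \<prec> a\<^sup>-\<^sup>1 \<prec> h\<close> and \<open>a \<in> H\<close>; thus
  \<open>a\<close> and \<open>a h\<close> are equivalent.
\<close>

definition quotient_qo :: "('a, 'b) monoid_scheme \<Rightarrow> 'a rel \<Rightarrow> 'a set \<Rightarrow> 'a set rel" where
  "quotient_qo K r H =
     {(H #>\<^bsub>K\<^esub> a, H #>\<^bsub>K\<^esub> b) | a b.
        a \<in> carrier K \<and> b \<in> carrier K \<and> (a \<in> H \<or> (b \<notin> H \<and> (a, b) \<in> r))}"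

definition o_type :: "('a, 'b) monoid_scheme \<Rightarrow> 'a rel \<Rightarrow> 'a \<Rightarrow> bool" where
  "o_type G r g \<longleftrightarrow> g = \<one>\<^bsub>G\<^esub> \<or> \<not> qo_equiv r g (inv\<^bsub>G\<^esub> g)"

definition o_plus_type :: "('a, 'b) monoid_scheme \<Rightarrow> 'a rel \<Rightarrow> 'a \<Rightarrow> bool" where
  "o_plus_type G r g \<longleftrightarrow> qo_less r (inv\<^bsub>G\<^esub> g) g"

definition o_minus_type :: "('a, 'b) monoid_scheme \<Rightarrow> 'a rel \<Rightarrow> 'a \<Rightarrow> bool" where
  "o_minus_type G r g \<longleftrightarrow> qo_less r g (inv\<^bsub>G\<^esub> g)"

definition T_plus :: "('a, 'b) monoid_scheme \<Rightarrow> 'a rel \<Rightarrow> 'a \<Rightarrow> 'a set" where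
  "T_plus G r g =
     {h \<in> carrier G. o_plus_type G r h \<and>
        (\<forall>c\<in>carrier G. qo_between r g h c \<longrightarrow> o_plus_type G r c)}"

text \<open>
  The sets \<open>T\<^sub>g\<close>, \<open>G\<^sub>g\<close> and \<open>G\<^sup>g\<close> are only meaningful for \<open>g \<noteq> 1\<close> of o-type, that is, for \<open>g\<close> of
  \<open>o\<^sup>+\<close>-type or \<open>o\<^sup>-\<close>-type; in the latter case \<open>g\<close> is replaced by its inverse.
\<close>

definition T_set :: "('a, 'b) monoid_scheme \<Rightarrow> 'a rel \<Rightarrow> 'a \<Rightarrow> 'a set" where
  "T_set G r g =
     (let p = (if o_minus_type G r g then inv\<^bsub>G\<^esub> g else g)
      in T_plus G r p \<union> set_inv\<^bsub>G\<^esub> (T_plus G r p))"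

definition G_lower :: "('a, 'b) monoid_scheme \<Rightarrow> 'a rel \<Rightarrow> 'a \<Rightarrow> 'a set" where
  "G_lower G r g =
     (let p = (if o_minus_type G r g then inv\<^bsub>G\<^esub> g else g)
      in {h \<in> carrier G. (h, inv\<^bsub>G\<^esub> p) \<in> r \<and> (inv\<^bsub>G\<^esub> h, inv\<^bsub>G\<^esub> p) \<in> r})"

definition G_upper :: "('a, 'b) monoid_scheme \<Rightarrow> 'a rel \<Rightarrow> 'a \<Rightarrow> 'a set" where
  "G_upper G r g = G_lower G r g \<union> T_set G r g"

definition order_type_quotient :: "('a, 'b) monoid_scheme \<Rightarrow> 'a rel \<Rightarrow> 'a set \<Rightarrow> bool" where
  "order_type_quotient K r H \<longleftrightarrow>
     H \<lhd> K \<and> qo_strictly_convex (carrier K) r H \<and> order_type (K Mod H) (quotient_qo K r H)"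

end

theory Submission
  imports Defs
begin

text \<open>
  Replacing \<open>g\<close> by its inverse, let \<open>g\<^sup>-\<^sup>1 \<prec> g\<close>. The axioms translate into
  \<open>y \<prec> x \<longleftrightarrow> y\<^sup>-\<^sup>1 \<prec> x y\<^sup>-\<^sup>1\<close>, and \<open>g\<^sup>-\<^sup>1 \<prec> d \<precsim> g\<close> implies \<open>d\<^sup>-\<^sup>1 \<sim> g\<^sup>-\<^sup>1\<close>. Hence \<open>T\<^sub>g\<^sup>+\<close> is the set of all
  \<open>h \<succ> g\<^sup>-\<^sup>1\<close> with \<open>h\<^sup>-\<^sup>1 \<sim> g\<^sup>-\<^sup>1\<close>, and \<open>G\<^sup>g\<close> is the disjoint union of \<open>G\<^sub>g\<close>, \<open>T\<^sub>g\<^sup>+\<close> and its inverse; so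
  every element of \<open>T\<^sub>g\<^sup>+\<close> defines the same sets as \<open>g\<close>, which reduces products with elements of
  \<open>T\<^sub>g\<^sup>+\<close> to products with \<open>g\<close>. The set \<open>T\<^sub>g\<^sup>+\<close> is the positive cone, modulo \<open>G\<^sub>g\<close>, of the order on
  the quotient. If \<open>H\<close> is another such subgroup and \<open>h \<in> G\<^sub>g\<close> is positive modulo \<open>H\<close>, then \<open>g \<notin> H\<close>
  because \<open>1 \<prec> h \<prec> g\<close>, and \<open>g\<close> is positive modulo \<open>H\<close>; so \<open>g\<^sup>-\<^sup>1 \<prec> h\<close>, contradicting \<open>h \<in> G\<^sub>g\<close>.
\<close>

section \<open>C-relations, quasi-orders and total orders\<close>

lemma quasi_order_on_C_relation:
  assumes "C_relation_on A C" "e \<in> A"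
  shows "quasi_order_on A {(x, y) \<in> A \<times> A. \<not> C x y e}"
proof -
  have trans: "\<not> C x z e" if "x \<in> A" "y \<in> A" "z \<in> A" "\<not> C x y e" "\<not> C y z e" for x y z
    using that assms unfolding C_relation_on_def by blast
  have asym: "\<not> C x y e \<or> \<not> C y x e" if "x \<in> A" "y \<in> A" for x y
    using that assms unfolding C_relation_on_def by blast
  show ?thesis
    unfolding quasi_order_on_def preorder_on_def
  proof (intro conjI)
    show "trans {(x, y) \<in> A \<times> A. \<not> C x y e}" by (rule transI) (use trans in blast)
    show "refl_on A {(x, y) \<in> A \<times> A. \<not> C x y e}" using asym by (auto simp: refl_on_def)
    show "total_on A {(x, y) \<in> A \<times> A. \<not> C x y e}" using asym by (auto simp: total_on_def)
  qed auto
qed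

text \<open>Serves to recognise a quotient as order-type by exhibiting a total order on it.\<close>

lemma order_type_of_totally_ordered_group:
  fixes G (structure)
  assumes "totally_ordered_group G R"
  defines "C \<equiv> \<lambda>x y z. ((y, x) \<in> R \<and> y \<noteq> x \<and> (z, x) \<in> R \<and> z \<noteq> x) \<or> (y = z \<and> z \<noteq> x)"
  shows "order_type G {(x, y) \<in> carrier G \<times> carrier G. \<not> C x y \<one>}"
proof -
  interpret group G using assms by (simp add: totally_ordered_group_def)
  have lin: "linear_order_on (carrier G) R"
    and mono: "\<And>x y z. x \<in> carrier G \<Longrightarrow> y \<in> carrier G \<Longrightarrow> z \<in> carrier G \<Longrightarrow> (x, y) \<in> R \<Longrightarrow>
      (x \<otimes> z, y \<otimes> z) \<in> R \<and> (z \<otimes> x, z \<otimes> y) \<in> R"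
    using assms by (auto simp: totally_ordered_group_def)
  have trans: "(x, y) \<in> R \<Longrightarrow> (y, z) \<in> R \<Longrightarrow> (x, z) \<in> R"
    and antisym: "(x, y) \<in> R \<Longrightarrow> (y, x) \<in> R \<Longrightarrow> x = y" for x y z
    using lin unfolding order_on_defs by (blast dest: transD antisymD)+
  have total: "(x, y) \<in> R \<or> (y, x) \<in> R" if "x \<in> carrier G" "y \<in> carrier G" for x y
    using lin that unfolding order_on_defs total_on_def refl_on_def by metis
  have C: "C_relation_on (carrier G) C"
    unfolding C_relation_on_def
  proof (intro conjI ballI impI)
    fix x y z assume "x \<in> carrier G" "y \<in> carrier G" "z \<in> carrier G"
    show "C x z y" if "C x y z" using that by (auto simp: C_def)
    show "\<not> C y x z" if "C x y z" using that antisym by (auto simp: C_def)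
    show "C w y z \<or> C x w z" if "w \<in> carrier G" "C x y z" for w
    \<comment> \<open>For \<open>y, z < x\<close>, a point \<open>w < x\<close> may replace
      \<open>y\<close>, and a point \<open>w\<close> not below \<open>x\<close> may replace
      \<open>x\<close>. In the degenerate case \<open>y = z\<close> it matters whether
      \<open>w = z\<close>.\<close>
    proof (cases "(w, x) \<in> R \<and> w \<noteq> x")
      case True
      then show ?thesis using that by (auto simp: C_def)
    next
      case False
      then have "(x, w) \<in> R" using total[of x w] that \<open>x \<in> carrier G\<close> by auto
      then show ?thesis using that trans antisym unfolding C_def by metis
    qed
  qed (simp add: C_def)
  have "C (v \<otimes> x \<otimes> u) (v \<otimes> y \<otimes> u) (v \<otimes> z \<otimes> u)"
    if "x \<in> carrier G" "y \<in> carrier G" "z \<in> carrier G" "u \<in> carrier G" "v \<in> carrier G" "C x y z"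
    for x y z u v
  proof -
    have "(v \<otimes> a \<otimes> u, v \<otimes> b \<otimes> u) \<in> R" if "(a, b) \<in> R" "a \<in> carrier G" "b \<in> carrier G" for a b
      using mono that \<open>u \<in> carrier G\<close> \<open>v \<in> carrier G\<close> by simp
    then show ?thesis using that by (auto simp: C_def)
  qed
  then have "compatible_C_relation G C"
    using C unfolding compatible_C_relation_def by blast
  then have "C_relation_of G {(x, y) \<in> carrier G \<times> carrier G. \<not> C x y \<one>} C"
    unfolding C_relation_of_def by blast
  then show ?thesis
    unfolding order_type_def C_quasi_ordered_group_def
    using quasi_order_on_C_relation[OF C] assms(1) is_group by (auto simp: C_def)
qed

lemma (in group) mult_inv_cancel_middle:
  assumes "x \<in> carrier G" "y \<in> carrier G" "z \<in> carrier G"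
  shows "x \<otimes> inv y \<otimes> (y \<otimes> z) = x \<otimes> z"
proof -
  have "inv y \<otimes> (y \<otimes> z) = z" using assms by (simp flip: m_assoc)
  then show ?thesis using assms by (simp add: m_assoc)
qed

section \<open>Cosets and positive cones modulo a normal subgroup\<close>

context normal
begin

lemma rcos_eq_iff:
  assumes "a \<in> carrier G" "b \<in> carrier G"
  shows "H #> a = H #> b \<longleftrightarrow> b \<otimes> inv a \<in> H"
  using assms rcos_module[OF is_group, of a b] repr_independence[OF _ _ subgroup_axioms, of b a]
    rcos_self[OF _ subgroup_axioms, of b] by auto

lemma rcos_eq_H_iff:
  assumes "a \<in> carrier G"
  shows "H #> a = H \<longleftrightarrow> a \<in> H"
  using assms rcos_self subgroup_axioms coset_join2 by blast

lemma inv_FactGroup_rcos: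
  assumes "a \<in> carrier G"
  shows "inv\<^bsub>G Mod H\<^esub> (H #> a) = H #> inv a"
  using assms inv_FactGroup[of "H #> a"] rcos_inv[of a] rcosetsI[OF subset] by (simp add: FactGroup_def)

end

text \<open>\<open>P\<close> plays the preimage in \<open>G\<close> of the strictly positive
  elements of an ordered group \<open>G Mod H\<close>; closure under left multiplication by
  \<open>H\<close> makes it a union of cosets.\<close>

locale normal_cone = normal H G for H and G (structure) +
  fixes P
  assumes cone_subset: "P \<subseteq> carrier G"
    and cone_mult: "a \<in> P \<Longrightarrow> b \<in> P \<Longrightarrow> a \<otimes> b \<in> P"
    and normal_cone: "n \<in> H \<Longrightarrow> a \<in> P \<Longrightarrow> n \<otimes> a \<in> P"
    and cone_conj: "u \<in> carrier G \<Longrightarrow> a \<in> P \<Longrightarrow> u \<otimes> a \<otimes> inv u \<in> P"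
    and cone_inv: "a \<in> P \<Longrightarrow> inv a \<notin> P"
    and cone_disjoint: "a \<in> P \<Longrightarrow> a \<notin> H"
    and cone_total: "u \<in> carrier G \<Longrightarrow> u \<in> H \<or> u \<in> P \<or> inv u \<in> P"
begin

definition cone_order :: "'a set rel" where
  "cone_order = {(H #> a, H #> b) | a b. a \<in> carrier G \<and> b \<in> carrier G \<and> b \<otimes> inv a \<in> H \<union> P}"

lemma cone_mult_normal:
  assumes "n \<in> H" "a \<in> P" shows "a \<otimes> n \<in> P"
proof -
  have car: "a \<in> carrier G" "n \<in> carrier G" using assms cone_subset by auto
  have "a \<otimes> n \<otimes> inv a \<in> H" using assms car inv_op_closed2 by blast
  then have "a \<otimes> n \<otimes> inv a \<otimes> a \<in> P" using assms normal_cone by blast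
  then show ?thesis using car by (simp add: m_assoc)
qed

lemma cone_mult_closed:
  assumes "a \<in> H \<union> P" "b \<in> H \<union> P" shows "a \<otimes> b \<in> H \<union> P"
  using assms cone_mult normal_cone cone_mult_normal by auto

lemma cone_conj_closed:
  assumes "u \<in> carrier G" "a \<in> H \<union> P" shows "u \<otimes> a \<otimes> inv u \<in> H \<union> P"
  using assms cone_conj inv_op_closed2 by auto

text \<open>Independence of representatives: \<open>b (inv a)\<close> is the product of
  \<open>b (inv d)\<close>, \<open>d (inv c)\<close> and \<open>c (inv a)\<close>, whose outer
  factors lie in \<open>H\<close>.\<close>

lemma cone_order_iff:
  assumes "a \<in> carrier G" "b \<in> carrier G"
  shows "(H #> a, H #> b) \<in> cone_order \<longleftrightarrow> b \<otimes> inv a \<in> H \<union> P"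
proof
  assume "(H #> a, H #> b) \<in> cone_order"
  then obtain c d where cd: "c \<in> carrier G" "d \<in> carrier G" "d \<otimes> inv c \<in> H \<union> P"
      "H #> a = H #> c" "H #> b = H #> d"
    unfolding cone_order_def by blast
  then have "b \<otimes> inv d \<in> H" "c \<otimes> inv a \<in> H" using assms by (metis rcos_eq_iff)+
  then have "b \<otimes> inv d \<otimes> (d \<otimes> inv c) \<otimes> (c \<otimes> inv a) \<in> H \<union> P"
    using cd by (intro cone_mult_closed[OF cone_mult_closed]) auto
  moreover have "x \<otimes> inv d \<otimes> (d \<otimes> inv c) \<otimes> (c \<otimes> y) = x \<otimes> y"
    if "x \<in> carrier G" "y \<in> carrier G" for x y
    using that cd by (simp add: mult_inv_cancel_middle)
  ultimately show "b \<otimes> inv a \<in> H \<union> P" using assms by simp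
qed (use assms in \<open>auto simp: cone_order_def\<close>)

lemma cone_order_totally_ordered: "totally_ordered_group (G Mod H) cone_order"
  unfolding totally_ordered_group_def
proof (intro conjI ballI impI)
  show "group (G Mod H)" by (rule factorgroup_is_group)
  have carI: "\<And>X. X \<in> carrier (G Mod H) \<longleftrightarrow> (\<exists>a\<in>carrier G. X = H #> a)"
    by (auto simp: FactGroup_def RCOSETS_def)
  have memE: "\<And>X Y. (X, Y) \<in> cone_order \<Longrightarrow> X \<in> carrier (G Mod H) \<and> Y \<in> carrier (G Mod H)"
    unfolding carI by (auto simp: cone_order_def)
  show "linear_order_on (carrier (G Mod H)) cone_order"
    unfolding order_on_defs
  proof (intro conjI)
    show "cone_order \<subseteq> carrier (G Mod H) \<times> carrier (G Mod H)" using memE by auto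
    show "refl_on (carrier (G Mod H)) cone_order"
      unfolding refl_on_def Ball_def carI by (auto simp: cone_order_iff)
    show "total_on (carrier (G Mod H)) cone_order"
      unfolding total_on_def Ball_def carI
    proof (intro allI impI; elim bexE)
      fix X Y a b assume *: "a \<in> carrier G" "X = H #> a" "b \<in> carrier G" "Y = H #> b"
      then have "inv (b \<otimes> inv a) = a \<otimes> inv b" by (simp add: inv_mult_group)
      then show "(X, Y) \<in> cone_order \<or> (Y, X) \<in> cone_order"
        using * cone_total[of "b \<otimes> inv a"] by (auto simp: cone_order_iff)
    qed
    show "trans cone_order"
    proof (rule transI)
      fix X Y Z assume XYZ: "(X, Y) \<in> cone_order" "(Y, Z) \<in> cone_order"
      obtain a b c where *: "a \<in> carrier G" "b \<in> carrier G" "c \<in> carrier G"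
          "X = H #> a" "Y = H #> b" "Z = H #> c"
        using memE[OF XYZ(1)] memE[OF XYZ(2)] unfolding carI by blast
      then have "c \<otimes> inv b \<otimes> (b \<otimes> inv a) \<in> H \<union> P"
        using XYZ cone_mult_closed by (simp only: cone_order_iff)
      moreover have "c \<otimes> inv b \<otimes> (b \<otimes> inv a) = c \<otimes> inv a"
        using * by (simp add: mult_inv_cancel_middle)
      ultimately show "(X, Z) \<in> cone_order" using * by (simp add: cone_order_iff)
    qed
    show "antisym cone_order"
    proof (rule antisymI)
      fix X Y assume XY: "(X, Y) \<in> cone_order" "(Y, X) \<in> cone_order"
      obtain a b where *: "a \<in> carrier G" "b \<in> carrier G" "X = H #> a" "Y = H #> b"
        using memE[OF XY(1)] unfolding carI by blast
      then have inv: "inv (b \<otimes> inv a) = a \<otimes> inv b" by (simp add: inv_mult_group)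
      have "b \<otimes> inv a \<in> H \<union> P" "inv (b \<otimes> inv a) \<in> H \<union> P"
        unfolding inv using XY * by (simp_all only: cone_order_iff)
      moreover have "b \<otimes> inv a \<in> H" if "inv (b \<otimes> inv a) \<in> H"
        using m_inv_closed[OF that] * by simp
      ultimately have "b \<otimes> inv a \<in> H" using cone_inv by blast
      then show "X = Y" using * by (simp add: rcos_eq_iff)
    qed
  qed
  fix X Y Z
  assume "X \<in> carrier (G Mod H)" "Y \<in> carrier (G Mod H)" "Z \<in> carrier (G Mod H)"
    and XY: "(X, Y) \<in> cone_order"
  then obtain a b c where *: "a \<in> carrier G" "b \<in> carrier G" "c \<in> carrier G"
      "X = H #> a" "Y = H #> b" "Z = H #> c"
    unfolding carI by blast
  have ba: "b \<otimes> inv a \<in> H \<union> P" using XY * by (simp only: cone_order_iff)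
  \<comment> \<open>Right translation leaves \<open>b (inv a)\<close> unchanged; left translation by
    \<open>c\<close> conjugates it, which is where invariance of the cone under conjugation
    enters.\<close>
  have "b \<otimes> c \<otimes> inv (a \<otimes> c) = b \<otimes> inv a"
    using * mult_inv_cancel_middle[of b "inv c" "inv a"] by (simp add: inv_mult_group m_assoc)
  then show "(X \<otimes>\<^bsub>G Mod H\<^esub> Z, Y \<otimes>\<^bsub>G Mod H\<^esub> Z) \<in> cone_order"
    using * ba by (simp add: FactGroup_def rcos_sum cone_order_iff)
  have "c \<otimes> b \<otimes> inv (c \<otimes> a) = c \<otimes> (b \<otimes> inv a) \<otimes> inv c"
    using * by (simp add: inv_mult_group m_assoc)
  then show "(Z \<otimes>\<^bsub>G Mod H\<^esub> X, Z \<otimes>\<^bsub>G Mod H\<^esub> Y) \<in> cone_order"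
    using * cone_conj_closed[OF _ ba] by (simp add: FactGroup_def rcos_sum cone_order_iff)
qed

lemma strict_cone_order_iff:
  assumes "a \<in> carrier G" "b \<in> carrier G"
  shows "(H #> a, H #> b) \<in> cone_order \<and> H #> a \<noteq> H #> b \<longleftrightarrow> b \<otimes> inv a \<in> P"
  using assms cone_disjoint by (auto simp: cone_order_iff rcos_eq_iff)

text \<open>The hypothesis says that outside \<open>H\<close> the relation \<open>r\<close> fails
  exactly when \<open>\<one> < a\<close> and \<open>b < a\<close> modulo \<open>H\<close>, as the
  order-type C-relation with third argument \<open>\<one>\<close> requires. Members of
  \<open>H\<close> are treated separately in \<open>quotient_qo\<close>.\<close>

lemma order_type_Mod:
  assumes r: "\<And>a b. a \<in> carrier G \<Longrightarrow> b \<in> carrier G \<Longrightarrow> a \<notin> H \<Longrightarrow> b \<notin> H \<Longrightarrow>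
    (a, b) \<in> r \<longleftrightarrow> \<not> (a \<in> P \<and> a \<otimes> inv b \<in> P)"
  shows "order_type (G Mod H) (quotient_qo G r H)"
proof -
  define C where "C = (\<lambda>x y z. ((y, x) \<in> cone_order \<and> y \<noteq> x \<and> (z, x) \<in> cone_order \<and> z \<noteq> x)
    \<or> (y = z \<and> z \<noteq> x))"
  have one: "\<one>\<^bsub>G Mod H\<^esub> = H #> \<one>" by (simp add: FactGroup_def coset_mult_one subset)
  \<comment> \<open>The disjunct \<open>b \<in> H \<and> a \<notin> H\<close> is the degenerate
    clause \<open>y = z \<noteq> x\<close> at \<open>z = \<one>\<close>.\<close>
  have C: "C (H #> a) (H #> b) \<one>\<^bsub>G Mod H\<^esub> \<longleftrightarrow>
      (a \<otimes> inv b \<in> P \<and> a \<in> P) \<or> (b \<in> H \<and> a \<notin> H)" if "a \<in> carrier G" "b \<in> carrier G" for a b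
  proof -
    have "H #> b = H #> \<one> \<longleftrightarrow> b \<in> H" "H #> \<one> = H #> a \<longleftrightarrow> a \<in> H"
      using that rcos_eq_H_iff by (auto simp: coset_mult_one subset)
    then show ?thesis
      using strict_cone_order_iff[of b a] strict_cone_order_iff[of \<one> a] that
      unfolding C_def one by auto
  qed
  have cond: "(a \<in> H \<or> b \<notin> H \<and> (a, b) \<in> r) = (\<not> C (H #> a) (H #> b) \<one>\<^bsub>G Mod H\<^esub>)"
    if "a \<in> carrier G" "b \<in> carrier G" for a b
    using C r that cone_disjoint by blast
  have "quotient_qo G r H =
      {(H #> a, H #> b) | a b. a \<in> carrier G \<and> b \<in> carrier G \<and> \<not> C (H #> a) (H #> b) \<one>\<^bsub>G Mod H\<^esub>}"
    unfolding quotient_qo_def using cond by (intro Collect_cong ex_cong1) auto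
  also have "\<dots> = {(X, Y) \<in> carrier (G Mod H) \<times> carrier (G Mod H). \<not> C X Y \<one>\<^bsub>G Mod H\<^esub>}"
    by (auto simp: FactGroup_def RCOSETS_def)
  finally have "quotient_qo G r H =
      {(X, Y) \<in> carrier (G Mod H) \<times> carrier (G Mod H). \<not> C X Y \<one>\<^bsub>G Mod H\<^esub>}" .
  then show ?thesis
    using order_type_of_totally_ordered_group[OF cone_order_totally_ordered]
    unfolding C_def by simp
qed

end

text \<open>The form in which order-type enters the minimality argument: \<open>P\<close> is the
  strict positive cone of the total order, and \<open>inv y \<le> \<one> < x\<close> gives
  \<open>C x (inv y) \<one>\<close>.\<close>

lemma order_type_positive_not_le_negative:
  fixes G (structure)
  assumes "order_type G r"
  obtains P where "\<forall>x\<in>carrier G. x \<noteq> \<one> \<longrightarrow> x \<in> P \<or> inv x \<in> P"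
    and "\<forall>x\<in>P. \<forall>y\<in>P. (x, inv y) \<notin> r"
proof -
  obtain C R where group: "group G" and C_r: "C_relation_of G r C"
    and R: "totally_ordered_group G R"
    and C: "\<forall>x\<in>carrier G. \<forall>y\<in>carrier G. \<forall>z\<in>carrier G.
           C x y z \<longleftrightarrow> ((y, x) \<in> R \<and> y \<noteq> x \<and> (z, x) \<in> R \<and> z \<noteq> x) \<or> (y = z \<and> z \<noteq> x)"
    using assms unfolding order_type_def C_quasi_ordered_group_def by blast
  interpret group G by (rule group)
  have lin: "linear_order_on (carrier G) R"
    and mono: "\<And>x y z. x \<in> carrier G \<Longrightarrow> y \<in> carrier G \<Longrightarrow> z \<in> carrier G \<Longrightarrow> (x, y) \<in> R \<Longrightarrow>
      (x \<otimes> z, y \<otimes> z) \<in> R"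
    using R by (auto simp: totally_ordered_group_def)
  have trans: "(x, y) \<in> R \<Longrightarrow> (y, z) \<in> R \<Longrightarrow> (x, z) \<in> R"
    and antisym: "(x, y) \<in> R \<Longrightarrow> (y, x) \<in> R \<Longrightarrow> x = y" for x y z
    using lin unfolding order_on_defs by (blast dest: transD antisymD)+
  have total: "(x, y) \<in> R \<or> (y, x) \<in> R" if "x \<in> carrier G" "y \<in> carrier G" for x y
    using lin that unfolding order_on_defs total_on_def refl_on_def by metis
  define P where "P = {x \<in> carrier G. (\<one>, x) \<in> R \<and> x \<noteq> \<one>}"
  have "x \<in> P \<or> inv x \<in> P" if "x \<in> carrier G" "x \<noteq> \<one>" for x
    using total[of \<one> x] mono[of x \<one> "inv x"] that by (auto simp: P_def)
  moreover have "(x, inv y) \<notin> r" if "x \<in> P" "y \<in> P" for x y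
  proof -
    have xy: "x \<in> carrier G" "y \<in> carrier G" "(\<one>, x) \<in> R" "\<one> \<noteq> x" "(\<one>, y) \<in> R"
      using that by (auto simp: P_def)
    then have "(inv y, \<one>) \<in> R" using mono[of \<one> y "inv y"] by simp
    then have "(inv y, x) \<in> R" "inv y \<noteq> x" using xy trans antisym by blast+
    then have "C x (inv y) \<one>" using C xy by simp
    then show ?thesis using C_r xy unfolding C_relation_of_def by simp
  qed
  ultimately show ?thesis using that[of P] by blast
qed

section \<open>C-quasi-ordered groups: translation, conjugation and inversion\<close>

locale cqo_group = group G for G (structure) and r :: "'a rel" and C +
  assumes quasi_order: "quasi_order_on (carrier G) r"
    and C_relation: "C_relation_of G r C"
begin

abbreviation le (infix "\<lesssim>" 50) where "x \<lesssim> y \<equiv> (x, y) \<in> r"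
text \<open>On the carrier totality makes the negated converse the strict part, and
  \<open>y \<prec> x\<close> becomes \<open>C x y \<one>\<close>.\<close>

abbreviation lt (infix "\<prec>" 50) where "x \<prec> y \<equiv> (y, x) \<notin> r"

lemma le_total: "x \<in> carrier G \<Longrightarrow> y \<in> carrier G \<Longrightarrow> x \<lesssim> y \<or> y \<lesssim> x"
  using quasi_order unfolding quasi_order_on_def preorder_on_def total_on_def refl_on_def
  by (cases "x = y") auto

lemma le_trans: "x \<lesssim> y \<Longrightarrow> y \<lesssim> z \<Longrightarrow> x \<lesssim> z"
  using quasi_order unfolding quasi_order_on_def preorder_on_def by (blast dest: transD)

lemma le_refl: "x \<in> carrier G \<Longrightarrow> x \<lesssim> x"
  using le_total by blast

lemma qo_less_iff: "x \<in> carrier G \<Longrightarrow> y \<in> carrier G \<Longrightarrow> qo_less r x y \<longleftrightarrow> x \<prec> y"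
  unfolding qo_less_def qo_equiv_def using le_total by blast

lemma
  assumes "x \<in> carrier G" "y \<in> carrier G" "z \<in> carrier G"
  shows C_swap: "C x y z \<Longrightarrow> C x z y"
    and C_asym: "C x y z \<Longrightarrow> \<not> C y x z"
    and C_cut: "w \<in> carrier G \<Longrightarrow> C x y z \<Longrightarrow> C w y z \<or> C x w z"
    and C_refl: "x \<noteq> y \<Longrightarrow> C x y y"
  using C_relation assms
  unfolding C_relation_of_def compatible_C_relation_def C_relation_on_def by blast+

lemma C_translate:
  assumes "x \<in> carrier G" "y \<in> carrier G" "z \<in> carrier G" "u \<in> carrier G" "v \<in> carrier G"
    "C x y z"
  shows "C (v \<otimes> x \<otimes> u) (v \<otimes> y \<otimes> u) (v \<otimes> z \<otimes> u)"
  using C_relation assms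
  unfolding C_relation_of_def compatible_C_relation_def by metis

lemma C_left:
  assumes "x \<in> carrier G" "y \<in> carrier G" "z \<in> carrier G" "v \<in> carrier G" "C x y z"
  shows "C (v \<otimes> x) (v \<otimes> y) (v \<otimes> z)"
  using C_translate[of x y z \<one> v] assms by simp

lemma C_right:
  assumes "x \<in> carrier G" "y \<in> carrier G" "z \<in> carrier G" "u \<in> carrier G" "C x y z"
  shows "C (x \<otimes> u) (y \<otimes> u) (z \<otimes> u)"
  using C_translate[of x y z u \<one>] assms by simp

lemma lt_iff_C: "x \<in> carrier G \<Longrightarrow> y \<in> carrier G \<Longrightarrow> y \<prec> x \<longleftrightarrow> C x y \<one>"
  using C_relation unfolding C_relation_of_def by blast

lemma one_less: "x \<in> carrier G \<Longrightarrow> x \<noteq> \<one> \<Longrightarrow> \<one> \<prec> x"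
  by (simp add: lt_iff_C C_refl)

lemma one_le: "x \<in> carrier G \<Longrightarrow> \<one> \<lesssim> x"
  by (cases "x = \<one>") (use one_less le_total le_refl in auto)

text \<open>Symmetry of \<open>C\<close> in its last two arguments turns \<open>C x y \<one>\<close>
  into \<open>C x \<one> y\<close>; right multiplication by \<open>inv y\<close> brings
  \<open>\<one>\<close> back to the third place.\<close>

lemma lt_imp_shift_right:
  assumes "x \<in> carrier G" "y \<in> carrier G" "y \<prec> x"
  shows "inv y \<prec> x \<otimes> inv y"
proof -
  have "C x \<one> y" using assms by (simp add: lt_iff_C C_swap)
  then have "C (x \<otimes> inv y) (\<one> \<otimes> inv y) (y \<otimes> inv y)"
    using assms C_right[of x \<one> y "inv y"] by simp
  then show ?thesis using assms by (simp add: lt_iff_C)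
qed

text \<open>The passage from \<open>(x, y)\<close> to \<open>(x (inv y), inv y)\<close> is an
  involution, so the implication yields its own converse.\<close>

lemma lt_shift_right:
  assumes "x \<in> carrier G" "y \<in> carrier G"
  shows "y \<prec> x \<longleftrightarrow> inv y \<prec> x \<otimes> inv y"
  using lt_imp_shift_right[of x y] lt_imp_shift_right[of "x \<otimes> inv y" "inv y"] assms
  by (auto simp: m_assoc)

lemma lt_conj:
  assumes "x \<in> carrier G" "y \<in> carrier G" "u \<in> carrier G"
  shows "u \<otimes> y \<otimes> inv u \<prec> u \<otimes> x \<otimes> inv u \<longleftrightarrow> y \<prec> x"
proof -
  have *: "u \<otimes> y \<otimes> inv u \<prec> u \<otimes> x \<otimes> inv u"
    if "x \<in> carrier G" "y \<in> carrier G" "u \<in> carrier G" "y \<prec> x" for x y u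
    using C_translate[of x y \<one> "inv u" u] that by (simp add: lt_iff_C)
  have undo: "inv u \<otimes> (u \<otimes> z \<otimes> inv u) \<otimes> inv (inv u) = z" if "z \<in> carrier G" for z
    using that assms by (simp add: m_assoc) (simp flip: m_assoc)
  show ?thesis
    using *[of x y u] *[of "u \<otimes> x \<otimes> inv u" "u \<otimes> y \<otimes> inv u" "inv u"] assms undo
    by auto
qed

lemma le_conj:
  assumes "x \<in> carrier G" "y \<in> carrier G" "u \<in> carrier G"
  shows "u \<otimes> y \<otimes> inv u \<lesssim> u \<otimes> x \<otimes> inv u \<longleftrightarrow> y \<lesssim> x"
  using lt_conj[of y x u] assms by blast

lemma lt_shift_left:
  assumes "x \<in> carrier G" "y \<in> carrier G"
  shows "y \<prec> x \<longleftrightarrow> inv y \<prec> inv y \<otimes> x"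
  using lt_shift_right[OF assms] lt_conj[of "x \<otimes> inv y" "inv y" "inv y"] assms
  by (simp add: m_assoc)

lemma le_shift_right:
  assumes "x \<in> carrier G" "y \<in> carrier G"
  shows "x \<otimes> y \<lesssim> y \<longleftrightarrow> x \<lesssim> inv y"
  using lt_shift_right[of x "inv y"] assms by auto

lemma le_shift_left:
  assumes "x \<in> carrier G" "y \<in> carrier G"
  shows "y \<otimes> x \<lesssim> y \<longleftrightarrow> x \<lesssim> inv y"
  using lt_shift_left[of x "inv y"] assms by auto

text \<open>Otherwise \<open>inv g \<prec> inv d\<close> gives \<open>C g (d g) d\<close>, while
  \<open>inv g \<prec> d\<close> and \<open>d \<lesssim> g\<close> give \<open>C (d g) g d\<close>,
  against asymmetry.\<close>

lemma inv_le_inv_plus: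
  assumes "g \<in> carrier G" "d \<in> carrier G" "inv g \<prec> d" "d \<lesssim> g"
  shows "inv d \<lesssim> inv g"
proof (rule ccontr)
  assume "inv g \<prec> inv d"
  then have "g \<prec> inv d \<otimes> g" using le_shift_right[of "inv d" g] assms by auto
  then have "C (d \<otimes> (inv d \<otimes> g)) (d \<otimes> g) (d \<otimes> \<one>)"
    using assms by (intro C_left) (auto simp: lt_iff_C)
  then have "C g (d \<otimes> g) d" using assms by (simp flip: m_assoc)
  moreover have "C (d \<otimes> g) g \<one>"
    using le_shift_right[of d g] assms by (simp flip: lt_iff_C)
  \<comment> \<open>The cut axiom acts on the first two arguments, hence the swaps around it. The
    alternative \<open>C d g \<one>\<close> means \<open>g \<prec> d\<close>, which is
    excluded.\<close>
  then have "C d g \<one> \<or> C (d \<otimes> g) g d"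
    using C_cut[of "d \<otimes> g" \<one> g d] C_swap assms by (meson C_swap m_closed one_closed)
  then have "C (d \<otimes> g) g d" using assms by (simp flip: lt_iff_C)
  ultimately show False using C_asym assms by auto
qed

text \<open>For the second inequality the previous lemma is applied with \<open>d\<close> and
  \<open>inv g\<close> in the places of \<open>g\<close> and \<open>d\<close>:
  \<open>inv d \<prec> inv g\<close> would give
  \<open>g \<lesssim> inv d \<lesssim> inv g\<close>.\<close>

lemma inv_equiv_inv_plus:
  assumes "g \<in> carrier G" "d \<in> carrier G" "inv g \<prec> g" "inv g \<prec> d" "d \<lesssim> g"
  shows "inv d \<lesssim> inv g" "inv g \<lesssim> inv d"
proof -
  show 1: "inv d \<lesssim> inv g" using inv_le_inv_plus assms by blast
  show "inv g \<lesssim> inv d"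
  proof (rule ccontr)
    assume *: "inv d \<prec> inv g"
    moreover have "inv g \<lesssim> d" using assms le_total by auto
    ultimately have "g \<lesssim> inv d" using inv_le_inv_plus[of d "inv g"] assms by simp
    then show False using 1 assms le_trans by blast
  qed
qed

lemma lt_le_trans: "x \<prec> y \<Longrightarrow> y \<lesssim> z \<Longrightarrow> x \<prec> z"
  using le_trans by blast

lemma le_lt_trans: "x \<lesssim> y \<Longrightarrow> y \<prec> z \<Longrightarrow> x \<prec> z"
  using le_trans by blast

lemma lt_imp_le: "x \<in> carrier G \<Longrightarrow> y \<in> carrier G \<Longrightarrow> x \<prec> y \<Longrightarrow> x \<lesssim> y"
  using le_total by blast

definition lower :: "'a \<Rightarrow> 'a set" where
  "lower g = {h \<in> carrier G. h \<lesssim> inv g \<and> inv h \<lesssim> inv g}"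

text \<open>For \<open>inv g \<prec> g\<close> this is \<open>T_plus\<close> (see
  \<open>T_plus_eq\<close>), described without betweenness and in terms of the class of
  \<open>inv g\<close> alone.\<close>

definition pos :: "'a \<Rightarrow> 'a set" where
  "pos g = {h \<in> carrier G. inv h \<lesssim> inv g \<and> inv g \<lesssim> inv h \<and> inv g \<prec> h}"

text \<open>A form of \<open>G_upper\<close> suited to convexity; \<open>upper_eq\<close> recovers
  the union with inverses.\<close>

definition upper :: "'a \<Rightarrow> 'a set" where
  "upper g = {h \<in> carrier G. h \<lesssim> inv g} \<union> pos g"

end

section \<open>The sets attached to an element of \<open>o\<^sup>+\<close>-type\<close>

locale o_plus = cqo_group +
  fixes g
  assumes g_carrier [simp, intro]: "g \<in> carrier G" and g_plus: "inv g \<prec> g"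
begin

lemma le_imp_pos: "h \<in> carrier G \<Longrightarrow> inv g \<prec> h \<Longrightarrow> h \<lesssim> g \<Longrightarrow> h \<in> pos g"
  using inv_equiv_inv_plus[of g h] g_plus by (simp add: pos_def)

lemma g_pos: "g \<in> pos g"
  using g_plus by (simp add: pos_def le_refl)

lemma pos_carrier: "h \<in> pos g \<Longrightarrow> h \<in> carrier G"
  by (simp add: pos_def)

lemma inv_lt_pos: "h \<in> pos g \<Longrightarrow> inv h \<prec> h"
  using le_lt_trans[of "inv h" "inv g" h] by (simp add: pos_def)

text \<open>Allows the locale to be instantiated at any \<open>h \<in> pos g\<close>, to which
  results proved for \<open>g\<close> are then transferred.\<close>

lemma pos_o_plus:
  assumes "h \<in> pos g" shows "o_plus G r C h"
proof
  show "h \<in> carrier G" using assms by (simp add: pos_def)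
  show "inv h \<prec> h" using assms by (rule inv_lt_pos)
qed

text \<open>The three sets depend on \<open>g\<close> only through the class of
  \<open>inv g\<close>, which contains \<open>inv h\<close>.\<close>

lemma inv_equiv_change:
  assumes "h \<in> pos g"
  shows "lower h = lower g" "pos h = pos g" "upper h = upper g"
proof -
  have *: "inv h \<lesssim> inv g" "inv g \<lesssim> inv h" using assms by (auto simp: pos_def)
  then have iff: "x \<lesssim> inv h \<longleftrightarrow> x \<lesssim> inv g" "inv h \<lesssim> x \<longleftrightarrow> inv g \<lesssim> x" for x
    using le_trans by blast+
  show "lower h = lower g" "pos h = pos g" "upper h = upper g"
    unfolding lower_def pos_def upper_def iff by auto
qed

lemma le_pos_imp_pos:
  assumes "h \<in> pos g" "x \<in> carrier G" "inv g \<prec> x" "x \<lesssim> h"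
  shows "x \<in> pos g"
proof -
  interpret h: o_plus G r C h using pos_o_plus assms by blast
  have "inv h \<prec> x" using assms le_lt_trans[of "inv h" "inv g" x] by (simp add: pos_def)
  then show ?thesis using h.le_imp_pos[of x] inv_equiv_change(2)[of h] assms by simp
qed

lemma T_plus_eq: "T_plus G r g = pos g"
proof (intro equalityI subsetI)
  fix h assume "h \<in> T_plus G r g"
  then have h: "h \<in> carrier G" "inv h \<prec> h"
    and between: "\<And>c. c \<in> carrier G \<Longrightarrow> qo_between r g h c \<Longrightarrow> inv c \<prec> c"
    by (auto simp: T_plus_def o_plus_type_def qo_less_iff)
  consider "h \<lesssim> g" | "g \<prec> h" by blast
  then show "h \<in> pos g"
  proof cases
    case 1
    \<comment> \<open>Otherwise \<open>inv g\<close>, which is not of \<open>o\<^sup>+\<close>-type,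
      would lie between \<open>h\<close> and \<open>g\<close>.\<close>
    have "\<not> h \<lesssim> inv g"
      using between[of "inv g"] g_plus lt_imp_le[of "inv g" g] by (auto simp: qo_between_def)
    then show ?thesis using 1 h le_imp_pos by blast
  next
    case 2
    \<comment> \<open>The same argument based at \<open>h\<close>: \<open>inv h\<close> cannot lie
      between \<open>g\<close> and \<open>h\<close>, so \<open>g \<in> pos h\<close> and the two
      cones coincide.\<close>
    interpret h: o_plus G r C h by standard (use h in auto)
    have "inv h \<prec> g"
      using between[of "inv h"] h lt_imp_le[of "inv h" h] by (auto simp: qo_between_def)
    then have "g \<in> pos h" using h.le_imp_pos[of g] 2 h lt_imp_le[of g h] by simp
    then show ?thesis using h.inv_equiv_change(2)[of g] h.g_pos by simp
  qed
next
  fix h assume h: "h \<in> pos g"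
  have "inv c \<prec> c" if c: "c \<in> carrier G" and "qo_between r g h c" for c
  proof -
    have "c \<in> pos g"
      using that h le_pos_imp_pos[of g c] le_pos_imp_pos[of h c] g_pos g_plus
        lt_le_trans[of g "inv g" c] lt_le_trans[of h "inv g" c]
      by (auto simp: qo_between_def pos_def)
    then show ?thesis by (rule inv_lt_pos)
  qed
  moreover have "inv h \<prec> h" using h by (rule inv_lt_pos)
  ultimately show "h \<in> T_plus G r g"
    using h by (auto simp: T_plus_def o_plus_type_def qo_less_iff pos_def)
qed

text \<open>If \<open>h \<prec> inv g \<prec> inv h\<close>, then \<open>inv h\<close> is of
  \<open>o\<^sup>+\<close>-type, and the smaller of \<open>g\<close> and \<open>inv h\<close> lies
  in the cone of the larger. This makes \<open>inv g\<close> and \<open>h\<close> equivalent, a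
  contradiction.\<close>

lemma inv_le_if_lt:
  assumes "h \<in> carrier G" "h \<prec> inv g"
  shows "inv h \<lesssim> inv g"
proof (rule ccontr)
  assume *: "inv g \<prec> inv h"
  then interpret h: o_plus G r C "inv h"
    by unfold_locales
      (use assms lt_imp_le[of h "inv g"] le_lt_trans[of h "inv g" "inv h"] in auto)
  show False
  proof (cases "inv h \<lesssim> g")
    case True
    then show ?thesis using le_imp_pos[of "inv h"] assms * by (auto simp: pos_def)
  next
    case False
    have "h \<prec> g" using assms g_plus lt_imp_le[of "inv g" g] lt_le_trans[of "inv g" h g] by auto
    then have "g \<in> pos (inv h)" using h.le_imp_pos[of g] False assms lt_imp_le[of g "inv h"] by auto
    then show ?thesis using assms by (auto simp: pos_def)
  qed
qed

lemma lower_iff: "h \<in> carrier G \<Longrightarrow> h \<in> lower g \<longleftrightarrow> h \<lesssim> inv g \<and> inv h \<lesssim> inv g"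
  by (simp add: lower_def)

text \<open>If \<open>h \<lesssim> inv g\<close> but \<open>h \<notin> lower g\<close>, the previous
  lemma forces \<open>h\<close> to be equivalent to \<open>inv g\<close>, so
  \<open>inv h \<in> pos g\<close>.\<close>

lemma upper_eq: "upper g = lower g \<union> pos g \<union> set_inv (pos g)"
proof -
  have "h \<lesssim> inv g \<longleftrightarrow> h \<in> lower g \<or> inv h \<in> pos g" if "h \<in> carrier G" for h
    using that inv_le_if_lt[of h] by (auto simp: lower_def pos_def)
  moreover have "h \<in> set_inv (pos g) \<longleftrightarrow> h \<in> carrier G \<and> inv h \<in> pos g" for h
    by (auto simp: SET_INV_def pos_carrier intro!: bexI[of _ "inv h"])
  ultimately show ?thesis by (auto simp: upper_def lower_def pos_carrier)
qed

lemma upper_iff: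
  "h \<in> upper g \<longleftrightarrow> h \<in> carrier G \<and> (h \<in> lower g \<or> h \<in> pos g \<or> inv h \<in> pos g)"
  unfolding upper_eq
  by (auto simp: SET_INV_def pos_carrier lower_def intro!: bexI[of _ "inv h"])

lemma lower_subset_upper: "lower g \<subseteq> upper g"
  and pos_subset_upper: "pos g \<subseteq> upper g"
  unfolding upper_eq by blast+

lemma upper_inv: "h \<in> upper g \<Longrightarrow> inv h \<in> upper g"
  by (auto simp: upper_iff lower_def)

text \<open>If \<open>inv g \<prec> h k\<close>, cutting at \<open>h\<close> and translating by
  \<open>inv h\<close> gives \<open>(inv h) (inv g) \<prec> k \<lesssim> inv g\<close>, which two
  shifts turn into \<open>g h \<prec> h\<close>. But \<open>inv h \<prec> g\<close> shifts to
  \<open>h \<prec> g h\<close>.\<close>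

lemma lower_mult:
  assumes "h \<in> lower g" "k \<in> lower g"
  shows "h \<otimes> k \<lesssim> inv g"
proof (rule ccontr)
  have hk: "h \<in> carrier G" "k \<in> carrier G" "h \<lesssim> inv g" "inv h \<lesssim> inv g" "k \<lesssim> inv g"
    using assms by (auto simp: lower_def)
  assume "inv g \<prec> h \<otimes> k"
  then have "C (h \<otimes> k) (inv g) \<one>" using hk by (simp add: lt_iff_C)
  then have "C (h \<otimes> k) (inv g) h"
    using C_cut[of "h \<otimes> k" \<one> "inv g" h] C_swap hk lt_iff_C[of h "inv g"]
    by (meson C_swap inv_closed g_carrier m_closed one_closed)
  then have "C (inv h \<otimes> (h \<otimes> k)) (inv h \<otimes> inv g) (inv h \<otimes> h)"
    using hk by (intro C_left) auto
  then have "inv h \<otimes> inv g \<prec> k" using hk by (simp add: lt_iff_C flip: m_assoc)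
  then have "inv h \<otimes> inv g \<prec> inv g" using hk lt_le_trans[of k] by blast
  then have "g \<otimes> h \<prec> h"
    using lt_shift_left[of "inv g" "inv h \<otimes> inv g"] lt_shift_right[of "inv g" "inv h \<otimes> inv g"] hk
    by (simp add: inv_mult_group flip: m_assoc)
  moreover have "inv h \<prec> g" using hk g_plus le_lt_trans[of "inv h" "inv g" g] by blast
  then have "h \<prec> g \<otimes> h" using lt_shift_right[of g "inv h"] hk by simp
  ultimately show False using hk le_total[of h "g \<otimes> h"] by auto
qed

lemma lower_subgroup: "subgroup (lower g) G"
proof (rule subgroupI)
  show "lower g \<noteq> {}" using one_le[of "inv g"] by (auto simp: lower_def)
  show inv: "inv h \<in> lower g" if "h \<in> lower g" for h using that by (auto simp: lower_def)
  show "h \<otimes> k \<in> lower g" if "h \<in> lower g" "k \<in> lower g" for h k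
    using that lower_mult[of h k] lower_mult[of "inv k" "inv h"] inv[of h] inv[of k]
    by (simp add: lower_def inv_mult_group)
qed (auto simp: lower_def)

lemma pos_lower_disjoint: "h \<in> pos g \<Longrightarrow> h \<notin> lower g"
  by (auto simp: pos_def lower_def)

text \<open>The shifts bound both products by \<open>g\<close> and their inverses by
  \<open>inv g\<close>. As \<open>g\<close> is outside the subgroup \<open>lower g\<close>, so are
  the products, which therefore lie strictly above \<open>inv g\<close>.\<close>

lemma lower_mult_g:
  assumes "l \<in> lower g"
  shows "g \<otimes> l \<in> pos g" "l \<otimes> g \<in> pos g"
proof -
  have l: "l \<in> carrier G" "l \<lesssim> inv g" "inv l \<lesssim> inv g" using assms by (auto simp: lower_def)
  then have lg: "inv l \<lesssim> g" using g_plus lt_imp_le[of "inv g" g] le_trans[of "inv l" "inv g" g] by auto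
  have le: "g \<otimes> l \<lesssim> g" "l \<otimes> g \<lesssim> g"
    using le_shift_left[of l g] le_shift_right[of l g] l by auto
  have inv_le: "inv (g \<otimes> l) \<lesssim> inv g" "inv (l \<otimes> g) \<lesssim> inv g"
    using le_shift_right[of "inv l" "inv g"] le_shift_left[of "inv l" "inv g"] lg l
    by (auto simp: inv_mult_group)
  interpret lower: subgroup "lower g" G by (rule lower_subgroup)
  have "inv l \<otimes> (l \<otimes> g) = g" "g \<otimes> l \<otimes> inv l = g"
    using l by (simp_all add: m_assoc flip: m_assoc[of "inv l"])
  then have "g \<otimes> l \<notin> lower g" "l \<otimes> g \<notin> lower g"
    using lower.m_closed[of "g \<otimes> l" "inv l"] lower.m_closed[of "inv l" "l \<otimes> g"] assms
      pos_lower_disjoint[OF g_pos] by auto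
  then show "g \<otimes> l \<in> pos g" "l \<otimes> g \<in> pos g"
    using le inv_le l by (auto intro!: le_imp_pos simp: lower_iff)
qed

text \<open>Here the product is larger than \<open>g\<close>, so the roles are exchanged:
  \<open>g\<close> is shown to lie in \<open>pos (g k)\<close>, which then equals
  \<open>pos g\<close>.\<close>

lemma pos_mult_g:
  assumes "k \<in> pos g" shows "g \<otimes> k \<in> pos g"
proof -
  have k: "k \<in> carrier G" "inv k \<lesssim> inv g" "inv g \<prec> k" using assms by (auto simp: pos_def)
  have 1: "g \<prec> g \<otimes> k" using le_shift_left[of k g] lt_shift_left[of k "inv g"] k by simp
  have "inv k \<lesssim> g" using k g_plus lt_imp_le[of "inv g" g] le_trans[of "inv k" "inv g" g] by auto
  then have 2: "inv (g \<otimes> k) \<lesssim> inv g"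
    using le_shift_right[of "inv k" "inv g"] k by (simp add: inv_mult_group)
  have 3: "inv (g \<otimes> k) \<prec> g" using 2 g_plus le_lt_trans by blast
  have 4: "g \<lesssim> g \<otimes> k" using 1 k lt_imp_le by auto
  interpret gk: o_plus G r C "g \<otimes> k"
    by unfold_locales (use k lt_le_trans[OF 3 4] in auto)
  have "g \<in> pos (g \<otimes> k)" using gk.le_imp_pos[of g] 3 4 by simp
  then show ?thesis using gk.inv_equiv_change(2)[of g] gk.g_pos by simp
qed

end

text \<open>The statements for \<open>g\<close> are read at \<open>h\<close>, whose three sets are
  those of \<open>g\<close>.\<close>

lemma (in o_plus)
  assumes "h \<in> pos g"
  shows lower_mult_pos: "l \<in> lower g \<Longrightarrow> l \<otimes> h \<in> pos g"
    and pos_mult_lower: "l \<in> lower g \<Longrightarrow> h \<otimes> l \<in> pos g"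
    and pos_mult_pos: "k \<in> pos g \<Longrightarrow> h \<otimes> k \<in> pos g"
proof -
  interpret h: o_plus G r C h using pos_o_plus assms by blast
  show "l \<in> lower g \<Longrightarrow> l \<otimes> h \<in> pos g" "l \<in> lower g \<Longrightarrow> h \<otimes> l \<in> pos g"
    "k \<in> pos g \<Longrightarrow> h \<otimes> k \<in> pos g"
    using h.lower_mult_g[of l] h.pos_mult_g[of k] unfolding inv_equiv_change[OF assms] by blast+
qed

section \<open>The subgroup \<open>upper g\<close> and its quotient by
  \<open>lower g\<close>\<close>

context o_plus
begin

lemma le_pos_imp_upper:
  assumes "h \<in> pos g" "x \<in> carrier G" "x \<lesssim> h"
  shows "x \<in> upper g"
  using le_pos_imp_pos[of h x] assms by (auto simp: upper_def)

text \<open>For \<open>h \<lesssim> k\<close> both products are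
  \<open>\<lesssim> inv k \<lesssim> inv g\<close> by the shifts; the other case follows by
  inversion.\<close>

lemma quotient_upper:
  assumes "h \<in> pos g" "k \<in> pos g"
  shows "h \<otimes> inv k \<in> upper g" "inv k \<otimes> h \<in> upper g"
proof -
  have *: "h \<otimes> inv k \<in> upper g \<and> inv k \<otimes> h \<in> upper g"
    if "h \<in> pos g" "k \<in> pos g" "h \<lesssim> k" for h k
  proof -
    have hk: "h \<in> carrier G" "k \<in> carrier G" "inv k \<lesssim> inv g" using that by (auto simp: pos_def)
    then have "h \<otimes> inv k \<lesssim> inv k" "inv k \<otimes> h \<lesssim> inv k"
      using le_shift_right[of h "inv k"] le_shift_left[of h "inv k"] that by auto
    then show ?thesis
      using hk le_trans[of "h \<otimes> inv k" "inv k" "inv g"] le_trans[of "inv k \<otimes> h" "inv k" "inv g"]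
      by (simp add: upper_def)
  qed
  have car: "h \<in> carrier G" "k \<in> carrier G" using assms by (auto simp: pos_def)
  consider "h \<lesssim> k" | "k \<lesssim> h" using car le_total by blast
  then show "h \<otimes> inv k \<in> upper g" "inv k \<otimes> h \<in> upper g"
  proof (atomize (full), cases)
    case 1 then show "h \<otimes> inv k \<in> upper g \<and> inv k \<otimes> h \<in> upper g" using * assms by blast
  next
    case 2
    then have "k \<otimes> inv h \<in> upper g" "inv h \<otimes> k \<in> upper g" using * assms by blast+
    then show "h \<otimes> inv k \<in> upper g \<and> inv k \<otimes> h \<in> upper g"
      using upper_inv[of "k \<otimes> inv h"] upper_inv[of "inv h \<otimes> k"] car
      by (simp add: inv_mult_group)
  qed
qed

lemma upper_subgroup: "subgroup (upper g) G"
proof (rule subgroupI)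
  interpret lower: subgroup "lower g" G by (rule lower_subgroup)
  show "upper g \<subseteq> carrier G" by (auto simp: upper_iff)
  have "g \<in> upper g" using g_pos by (simp add: upper_iff)
  then show "upper g \<noteq> {}" by blast
  show "inv h \<in> upper g" if "h \<in> upper g" for h using that by (rule upper_inv)
  note U = lower_subset_upper[THEN subsetD] pos_subset_upper[THEN subsetD]
  show "h \<otimes> k \<in> upper g" if "h \<in> upper g" "k \<in> upper g" for h k
  proof -
    have hk: "h \<in> carrier G" "k \<in> carrier G" using that by (auto simp: upper_iff)
    \<comment> \<open>Products with a negative and no positive factor are inverted, which leaves
      factors in \<open>lower g\<close> and \<open>pos g\<close>.\<close>
    have inv: "x \<otimes> y \<in> upper g"
      if "inv y \<otimes> inv x \<in> upper g" "x \<in> carrier G" "y \<in> carrier G" for x y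
      using upper_inv[OF that(1)] that by (simp add: inv_mult_group)
    have "h \<in> lower g \<or> h \<in> pos g \<or> inv h \<in> pos g"
      "k \<in> lower g \<or> k \<in> pos g \<or> inv k \<in> pos g"
      using that by (auto simp: upper_iff)
    then show ?thesis
    proof (elim disjE)
      assume "h \<in> lower g" "k \<in> lower g"
      then show ?thesis by (intro U lower.m_closed)
    next
      assume "h \<in> lower g" "k \<in> pos g"
      then show ?thesis by (intro U lower_mult_pos)
    next
      assume a: "h \<in> lower g" "inv k \<in> pos g"
      show ?thesis
        by (rule inv) (use a hk pos_mult_lower[of "inv k" "inv h"] lower.m_inv_closed[of h] U in auto)
    next
      assume "h \<in> pos g" "k \<in> lower g"
      then show ?thesis by (intro U pos_mult_lower)
    next
      assume "h \<in> pos g" "k \<in> pos g"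
      then show ?thesis by (intro U pos_mult_pos)
    next
      assume "h \<in> pos g" "inv k \<in> pos g"
      then show ?thesis using quotient_upper(1)[of h "inv k"] hk by simp
    next
      assume a: "inv h \<in> pos g" "k \<in> lower g"
      show ?thesis
        by (rule inv) (use a hk lower_mult_pos[of "inv h" "inv k"] lower.m_inv_closed[of k] U in auto)
    next
      assume "inv h \<in> pos g" "k \<in> pos g"
      then show ?thesis using quotient_upper(2)[of k "inv h"] hk by simp
    next
      assume a: "inv h \<in> pos g" "inv k \<in> pos g"
      show ?thesis
        by (rule inv) (use a hk pos_mult_pos[of "inv k" "inv h"] U in auto)
    qed
  qed
qed

text \<open>\<open>upper g\<close> is an initial segment of the carrier.\<close>

lemma upper_convex: "qo_convex (carrier G) r (upper g)"
  unfolding qo_convex_def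
proof (intro conjI ballI impI)
  show "upper g \<subseteq> carrier G" by (auto simp: upper_iff)
  fix s t a assume "t \<in> upper g" "a \<in> carrier G" "(s, a) \<in> r \<and> (a, t) \<in> r"
  then show "a \<in> upper g" using le_pos_imp_upper[of t a] le_trans[of a t "inv g"] by (auto simp: upper_def)
qed

text \<open>Since \<open>lower u = lower g\<close>, the bound may be taken to be
  \<open>inv u\<close>, which is fixed by conjugation with \<open>u\<close> and
  \<open>inv u\<close>.\<close>

lemma pos_conj_lower:
  assumes "u \<in> pos g" "l \<in> lower g"
  shows "u \<otimes> l \<otimes> inv u \<in> lower g" "inv u \<otimes> l \<otimes> u \<in> lower g"
proof -
  interpret u: o_plus G r C u using pos_o_plus assms by blast
  have u: "u \<in> carrier G" by (rule u.g_carrier)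
  have lower: "lower u = lower g" using inv_equiv_change assms by blast
  have l: "l \<in> carrier G" "l \<lesssim> inv u" "inv l \<lesssim> inv u"
    using assms lower by (auto simp: lower_def)
  have "u \<otimes> x \<otimes> inv u \<lesssim> inv u" "inv u \<otimes> x \<otimes> u \<lesssim> inv u"
    if "x \<in> carrier G" "x \<lesssim> inv u" for x
    using le_conj[of "inv u" x u] le_conj[of "inv u" x "inv u"] u that by (auto simp: m_assoc)
  from this[of l] this[of "inv l"] show "u \<otimes> l \<otimes> inv u \<in> lower g" "inv u \<otimes> l \<otimes> u \<in> lower g"
    unfolding lower[symmetric] unfolding lower_def using l u by (auto simp: inv_mult_group m_assoc)
qed

lemma lower_normal: "lower g \<lhd> G\<lparr>carrier := upper g\<rparr>"
proof -
  interpret lower: subgroup "lower g" G by (rule lower_subgroup)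
  interpret U: group "G\<lparr>carrier := upper g\<rparr>" by (intro subgroup_imp_group upper_subgroup)
  have "subgroup (lower g) (G\<lparr>carrier := upper g\<rparr>)"
    by (intro subgroup_incl lower_subgroup upper_subgroup lower_subset_upper)
  moreover have "u \<otimes> l \<otimes> inv u \<in> lower g" if "u \<in> upper g" "l \<in> lower g" for u l
    using that pos_conj_lower[of u l] pos_conj_lower[of "inv u" l] by (auto simp: upper_iff)
  ultimately show ?thesis
    unfolding U.normal_inv_iff by (auto simp: m_inv_consistent[OF upper_subgroup])
qed

lemma pos_iff: "h \<in> upper g \<Longrightarrow> h \<in> pos g \<longleftrightarrow> inv g \<prec> h"
  by (auto simp: upper_def pos_def)

text \<open>Normality keeps the conjugate out of \<open>lower g\<close>, and the conjugate of
  \<open>inv h \<prec> h\<close> shows that its inverse is not positive.\<close>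

lemma pos_conj:
  assumes "u \<in> upper g" "h \<in> pos g"
  shows "u \<otimes> h \<otimes> inv u \<in> pos g"
proof -
  interpret U: group "G\<lparr>carrier := upper g\<rparr>" by (intro subgroup_imp_group upper_subgroup)
  interpret N: normal "lower g" "G\<lparr>carrier := upper g\<rparr>" by (rule lower_normal)
  have uh: "u \<in> carrier G" "h \<in> carrier G" using assms by (auto simp: upper_iff pos_def)
  have "inv h \<prec> h" using assms(2) by (rule inv_lt_pos)
  then have lt: "u \<otimes> inv h \<otimes> inv u \<prec> u \<otimes> h \<otimes> inv u"
    using lt_conj uh by blast
  have uhu: "u \<otimes> h \<otimes> inv u \<in> upper g"
    by (intro subgroup.m_closed[OF upper_subgroup] upper_inv) (use assms pos_subset_upper in auto)
  moreover have "u \<otimes> h \<otimes> inv u \<notin> lower g"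
  proof
    assume "u \<otimes> h \<otimes> inv u \<in> lower g"
    then have "inv u \<otimes> (u \<otimes> h \<otimes> inv u) \<otimes> inv (inv u) \<in> lower g"
      using N.inv_op_closed2[of "inv u" "u \<otimes> h \<otimes> inv u"] upper_inv[OF assms(1)]
      by (simp add: m_inv_consistent[OF upper_subgroup])
    moreover have "inv u \<otimes> (u \<otimes> h \<otimes> inv u) \<otimes> inv (inv u) = h"
      using uh by (simp add: m_assoc) (simp flip: m_assoc)
    ultimately have "h \<in> lower g" by simp
    then show False using assms pos_lower_disjoint by blast
  qed
  moreover have "inv (u \<otimes> h \<otimes> inv u) \<notin> pos g"
    using lt uh inv_lt_pos[of "inv (u \<otimes> h \<otimes> inv u)"]
      lt_imp_le[of "u \<otimes> inv h \<otimes> inv u" "u \<otimes> h \<otimes> inv u"]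
    by (auto simp: inv_mult_group m_assoc)
  ultimately show ?thesis by (auto simp: upper_iff)
qed

text \<open>Supplies the hypothesis of \<open>order_type_Mod\<close>. Elements of
  \<open>upper g\<close> outside \<open>lower g\<close> and \<open>pos g\<close> are all equivalent
  to \<open>inv g\<close>, hence below everything else outside \<open>lower g\<close>. For positive
  \<open>a\<close> and \<open>b\<close>, the shift turns \<open>b \<prec> a\<close> into
  \<open>inv b \<prec> a (inv b)\<close>, where \<open>inv b\<close> is equivalent to
  \<open>inv g\<close>.\<close>

lemma lt_iff_pos:
  assumes "a \<in> upper g" "b \<in> upper g" "a \<notin> lower g" "b \<notin> lower g"
  shows "b \<prec> a \<longleftrightarrow> a \<in> pos g \<and> a \<otimes> inv b \<in> pos g"
proof -
  have car: "a \<in> carrier G" "b \<in> carrier G" using assms by (auto simp: upper_iff)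
  have inv_pos: "x \<lesssim> inv g" "inv g \<lesssim> x" "inv x \<in> pos g"
    if "x \<in> upper g" "x \<notin> lower g" "x \<notin> pos g" for x
    using that by (auto simp: upper_iff pos_def)
  show ?thesis
  proof (cases "a \<in> pos g")
    case False
    then have "a \<lesssim> b"
      using inv_pos[of a] inv_pos[of b] assms car lt_imp_le[of "inv g" b] le_trans[of a "inv g" b]
      by (cases "b \<in> pos g") (auto simp: pos_def)
    then show ?thesis using False by simp
  next
    case a: True
    show ?thesis
    proof (cases "b \<in> pos g")
      case True
      then have b: "inv b \<lesssim> inv g" "inv g \<lesssim> inv b" by (auto simp: pos_def)
      have "b \<prec> a \<longleftrightarrow> inv b \<prec> a \<otimes> inv b" using lt_shift_right car by blast
      also have "\<dots> \<longleftrightarrow> inv g \<prec> a \<otimes> inv b" using b le_trans by blast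
      also have "\<dots> \<longleftrightarrow> a \<otimes> inv b \<in> pos g"
        using pos_iff quotient_upper(1)[OF a True] by simp
      finally show ?thesis using a by simp
    next
      case False
      then have b: "b \<lesssim> inv g" "inv b \<in> pos g" using inv_pos(1,3)[of b] assms by blast+
      then have "b \<prec> a" using le_lt_trans[of b "inv g" a] a by (simp add: pos_def)
      moreover have "a \<otimes> inv b \<in> pos g" using pos_mult_pos[OF a] b by blast
      ultimately show ?thesis using a by simp
    qed
  qed
qed

text \<open>An element strictly below some \<open>t \<lesssim> inv g\<close> is strictly below
  \<open>inv g\<close>, unlike positive elements and their inverses.\<close>

lemma lower_strictly_convex:
  "qo_strictly_convex (upper g) (r \<inter> upper g \<times> upper g) (lower g)"
  unfolding qo_strictly_convex_def
proof (intro conjI lower_subset_upper ballI impI)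
  fix s t a
  assume "t \<in> lower g" and a: "a \<in> upper g"
    and "qo_less (r \<inter> upper g \<times> upper g) s a \<and> qo_less (r \<inter> upper g \<times> upper g) a t"
  then have "a \<lesssim> t" "a \<prec> t" "t \<lesssim> inv g"
    using lower_subset_upper by (auto simp: qo_less_def qo_equiv_def lower_def)
  then have "a \<lesssim> inv g" "a \<prec> inv g" using le_trans by blast+
  then show "a \<in> lower g" using a by (auto simp: upper_iff pos_def)
qed

lemma lower_order_type_quotient:
  "order_type_quotient (G\<lparr>carrier := upper g\<rparr>) (r \<inter> upper g \<times> upper g) (lower g)"
proof -
  interpret U: normal "lower g" "G\<lparr>carrier := upper g\<rparr>" by (rule lower_normal)
  note inv_U = m_inv_consistent[OF upper_subgroup]
  interpret U: normal_cone "lower g" "G\<lparr>carrier := upper g\<rparr>" "pos g"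
  proof (unfold_locales, goal_cases)
    case 1 show ?case using pos_subset_upper by simp
  next
    case (2 a b) then show ?case using pos_mult_pos by simp
  next
    case (3 n a) then show ?case using lower_mult_pos by simp
  next
    case (4 u a) then show ?case using pos_conj by (simp add: inv_U)
  next
    case (5 a)
    then have "a \<in> upper g" using pos_subset_upper by blast
    moreover have "inv a \<notin> pos g"
      using inv_lt_pos[of a] inv_lt_pos[of "inv a"] lt_imp_le[of "inv a" a] pos_carrier 5 by auto
    ultimately show ?case by (simp add: inv_U)
  next
    case (6 a) then show ?case by (rule pos_lower_disjoint)
  next
    case (7 u) then show ?case by (simp add: inv_U) (auto simp: upper_iff)
  qed
  show ?thesis
    unfolding order_type_quotient_def
  proof (intro conjI lower_normal U.order_type_Mod)
    show "qo_strictly_convex (carrier (G\<lparr>carrier := upper g\<rparr>)) (r \<inter> upper g \<times> upper g) (lower g)"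
      using lower_strictly_convex by simp
    fix a b
    assume "a \<in> carrier (G\<lparr>carrier := upper g\<rparr>)" "b \<in> carrier (G\<lparr>carrier := upper g\<rparr>)"
      "a \<notin> lower g" "b \<notin> lower g"
    then show "(a, b) \<in> r \<inter> upper g \<times> upper g \<longleftrightarrow>
        \<not> (a \<in> pos g \<and> a \<otimes>\<^bsub>G\<lparr>carrier := upper g\<rparr>\<^esub> inv\<^bsub>G\<lparr>carrier := upper g\<rparr>\<^esub> b \<in> pos g)"
      using lt_iff_pos[of a b] by (auto simp: inv_U)
  qed
qed

section \<open>Minimality of \<open>lower g\<close>\<close>

lemma lower_minimal:
  assumes "order_type_quotient (G\<lparr>carrier := upper g\<rparr>) (r \<inter> upper g \<times> upper g) H"
  shows "lower g \<subseteq> H"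
proof (rule ccontr)
  let ?K = "G\<lparr>carrier := upper g\<rparr>" and ?r = "r \<inter> upper g \<times> upper g"
  have ot: "order_type (?K Mod H) (quotient_qo ?K ?r H)"
    and convex: "qo_strictly_convex (upper g) ?r H"
    using assms by (auto simp: order_type_quotient_def)
  interpret N: normal H ?K using assms by (simp add: order_type_quotient_def)
  interpret Q: group "?K Mod H" by (rule N.factorgroup_is_group)
  note inv_U = m_inv_consistent[OF upper_subgroup]
  obtain P where
    P: "\<forall>X\<in>carrier (?K Mod H). X \<noteq> \<one>\<^bsub>?K Mod H\<^esub> \<longrightarrow> X \<in> P \<or> inv\<^bsub>?K Mod H\<^esub> X \<in> P"
    and P_not_le: "\<forall>X\<in>P. \<forall>Y\<in>P. (X, inv\<^bsub>?K Mod H\<^esub> Y) \<notin> quotient_qo ?K ?r H"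
    by (rule order_type_positive_not_le_negative[OF ot])
  have cases: "H #>\<^bsub>?K\<^esub> x \<in> P \<or> H #>\<^bsub>?K\<^esub> inv x \<in> P" if "x \<in> upper g" "x \<notin> H" for x
    using P[rule_format, of "H #>\<^bsub>?K\<^esub> x"] N.inv_FactGroup_rcos[of x] N.rcos_eq_H_iff[of x] that
    by (auto simp: FactGroup_def RCOSETS_def inv_U)
  \<comment> \<open>The first alternative arises because \<open>quotient_qo\<close> consults
    \<open>r\<close> only when the right-hand representative is outside \<open>H\<close>.\<close>
  have not_le: "inv y \<in> H \<or> inv y \<prec> x"
    if "H #>\<^bsub>?K\<^esub> x \<in> P" "H #>\<^bsub>?K\<^esub> y \<in> P" "x \<in> upper g" "y \<in> upper g" for x y
    using P_not_le[rule_format, OF that(1,2)] N.inv_FactGroup_rcos[of y] that upper_inv[of y]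
    by (auto simp: quotient_qo_def inv_U)
  have inv_H: "inv x \<notin> H" if "x \<in> upper g" "x \<notin> H" for x
    using N.m_inv_closed[of "inv x"] inv_U[OF upper_inv[OF that(1)]] that
    by (auto simp: upper_iff)
  assume "\<not> lower g \<subseteq> H"
  then obtain h where h: "h \<in> lower g" "h \<notin> H" by blast
  have hU: "h \<in> upper g" "inv h \<in> upper g" "inv h \<in> lower g"
    using h lower_subset_upper upper_inv subgroup.m_inv_closed[OF lower_subgroup] by auto
  \<comment> \<open>\<open>k\<close> is whichever of \<open>h\<close> and \<open>inv h\<close> is
    positive modulo \<open>H\<close>.\<close>
  obtain k where k: "k \<in> lower g" "k \<notin> H" "k \<in> upper g" "H #>\<^bsub>?K\<^esub> k \<in> P"
    using cases[of h] inv_H[of h] h hU by blast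
  then have k_le: "k \<in> carrier G" "k \<lesssim> inv g" by (auto simp: lower_def)
  have gU: "g \<in> upper g" "inv g \<in> upper g" using g_pos pos_subset_upper upper_inv by blast+
  have g: "g \<notin> H"
  proof
    assume "g \<in> H"
    moreover have "\<one> \<in> H" using subgroup.one_closed[OF N.subgroup_axioms] by simp
    moreover have "k \<noteq> \<one>" using \<open>\<one> \<in> H\<close> k by blast
    then have "qo_less ?r \<one> k"
      using k_le one_less[of k] one_le[of k] k N.subset \<open>\<one> \<in> H\<close>
      by (auto simp: qo_less_def qo_equiv_def)
    moreover have "k \<prec> g" using k_le le_lt_trans g_plus by blast
    then have "qo_less ?r k g"
      using lt_imp_le[of k g] k_le k gU by (auto simp: qo_less_def qo_equiv_def)
    ultimately show False using convex k unfolding qo_strictly_convex_def by blast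
  qed
  \<comment> \<open>Otherwise \<open>not_le\<close> with \<open>inv g\<close> for both elements
    would give \<open>g \<in> H\<close> or \<open>g \<prec> inv g\<close>.\<close>
  have "H #>\<^bsub>?K\<^esub> inv g \<notin> P"
    using not_le[of "inv g" "inv g"] gU g g_plus lt_imp_le[of "inv g" g] by auto
  then have "H #>\<^bsub>?K\<^esub> g \<in> P" using cases gU g by blast
  then show False using not_le[of k g] k gU inv_H g k_le by blast
qed

end

theorem proposition3p17:
  fixes G :: "('a, 'b) monoid_scheme" and r :: "'a rel" and g :: 'a
  assumes "C_quasi_ordered_group G r"
    and "g \<in> carrier G" and "g \<noteq> \<one>\<^bsub>G\<^esub>" and "o_type G r g"
  defines "U \<equiv> G_upper G r g" and "L \<equiv> G_lower G r g"
  defines "K \<equiv> G\<lparr>carrier := U\<rparr>" and "rK \<equiv> r \<inter> U \<times> U"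
  shows "subgroup U G \<and> subgroup L G \<and> qo_convex (carrier G) r U \<and>
         order_type_quotient K rK L \<and>
         (\<forall>H. order_type_quotient K rK H \<longrightarrow> L \<subseteq> H)"
proof -
  obtain C where "group G" "quasi_order_on (carrier G) r" "C_relation_of G r C"
    using assms(1) by (auto simp: C_quasi_ordered_group_def)
  then interpret cqo_group G r C by (intro cqo_group.intro cqo_group_axioms.intro)
  \<comment> \<open>The same choice as inside \<open>T_set\<close> and \<open>G_lower\<close>; under
    the hypotheses on \<open>g\<close> it is of \<open>o\<^sup>+\<close>-type.\<close>
  define p where "p = (if o_minus_type G r g then inv\<^bsub>G\<^esub> g else g)"
  have "p \<in> carrier G" using assms(2) by (simp add: p_def)
  moreover have "(p, inv\<^bsub>G\<^esub> p) \<notin> r"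
    using assms(2-4) le_total[of g "inv\<^bsub>G\<^esub> g"]
    by (auto simp: p_def o_type_def o_minus_type_def qo_less_def qo_equiv_def)
  ultimately interpret o_plus G r C p by unfold_locales
  have L: "L = lower p" by (simp add: L_def G_lower_def lower_def p_def Let_def)
  have U: "U = upper p"
    using L by (simp add: U_def G_upper_def L_def T_set_def T_plus_eq upper_eq Un_assoc Let_def flip: p_def)
  show ?thesis
    unfolding K_def rK_def L U
    using upper_subgroup lower_subgroup upper_convex lower_order_type_quotient lower_minimal by blast
qed

end
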